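(* Let $A$ be any mv-algebra. Then the prime spectral space $Z_A$ (the set of prime ideals of $A$ with the coZariski topology) is sober, compact, and has a base of compact open sets.
   Context: An mv-algebra is a set $A$ with a binary operation $\oplus$, a unary operation $\neg$ and a constant $0$ such that $(A,\oplus,0)$ is a commutative monoid, $\neg\neg x = x$, $x\oplus\neg 0=\neg 0$ and $\neg(\neg x\oplus y)\oplus y=\neg(\neg y\oplus x)\oplus x$. Derived: $1=\neg 0$, $x\ominus y=\neg(\neg x\oplus y)$; $x\le y \iff x\ominus y=0$ is a lattice order. An ideal is a subset $I\subset A$ containing $0$, downward closed, and closed under $\oplus$. An ideal $P$ is prime if $1\notin P$ and for all $x,y\in A$, $x\ominus y\in P$ or $y\ominus x\in P$. $Z_A$ is the set of all prime ideals of $A$ with the coZariski topology, whose open base is given by the sets $W_a=\{P\in Z_A : a\in P\}$, $a\in A$. Compact means that every open cover has a finite subcover (Hausdorffness not required). Sober means that every nonempty irreducible closed subset has a unique generic point. *)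

theory Defs
  imports "HOL-Analysis.Abstract_Topology"
begin

locale mv_algebra =
  fixes A :: "'a set"
    and oplus :: "'a \<Rightarrow> 'a \<Rightarrow> 'a"  (infixl \<open>\<oplus>\<close> 65)
    and neg :: "'a \<Rightarrow> 'a"
    and zero :: 'a
  assumes oplus_closed: "\<lbrakk>x \<in> A; y \<in> A\<rbrakk> \<Longrightarrow> x \<oplus> y \<in> A"
    and neg_closed: "x \<in> A \<Longrightarrow> neg x \<in> A"
    and zero_closed: "zero \<in> A"
    and oplus_assoc: "\<lbrakk>x \<in> A; y \<in> A; z \<in> A\<rbrakk> \<Longrightarrow> (x \<oplus> y) \<oplus> z = x \<oplus> (y \<oplus> z)"
    and oplus_comm: "\<lbrakk>x \<in> A; y \<in> A\<rbrakk> \<Longrightarrow> x \<oplus> y = y \<oplus> x"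
    and oplus_zero: "x \<in> A \<Longrightarrow> x \<oplus> zero = x"
    and neg_neg: "x \<in> A \<Longrightarrow> neg (neg x) = x"
    and oplus_neg_zero: "x \<in> A \<Longrightarrow> x \<oplus> neg zero = neg zero"
    and mv_axiom:
      "\<lbrakk>x \<in> A; y \<in> A\<rbrakk> \<Longrightarrow> neg (neg x \<oplus> y) \<oplus> y = neg (neg y \<oplus> x) \<oplus> x"
begin

definition one :: 'a
  where "one = neg zero"

definition ominus :: "'a \<Rightarrow> 'a \<Rightarrow> 'a"  (infixl \<open>\<ominus>\<close> 65)
  where "x \<ominus> y = neg (neg x \<oplus> y)"

definition le :: "'a \<Rightarrow> 'a \<Rightarrow> bool"
  where "le x y \<longleftrightarrow> x \<ominus> y = zero"

definition is_ideal :: "'a set \<Rightarrow> bool"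
  where "is_ideal I \<longleftrightarrow>
    I \<subseteq> A \<and> zero \<in> I \<and>
    (\<forall>x\<in>A. \<forall>y\<in>I. le x y \<longrightarrow> x \<in> I) \<and>
    (\<forall>x\<in>I. \<forall>y\<in>I. x \<oplus> y \<in> I)"

definition prime_ideal :: "'a set \<Rightarrow> bool"
  where "prime_ideal P \<longleftrightarrow>
    is_ideal P \<and> one \<notin> P \<and> (\<forall>x\<in>A. \<forall>y\<in>A. x \<ominus> y \<in> P \<or> y \<ominus> x \<in> P)"

definition W :: "'a \<Rightarrow> 'a set set"
  where "W a = {P. prime_ideal P \<and> a \<in> P}"

text \<open>The prime spectral space, i.e. the set of prime ideals with the coZariski topology:
  the open sets are exactly the unions of sets \<^term>\<open>W a\<close>.\<close>

definition Z :: "'a set topology"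
  where "Z = topology (arbitrary union_of (\<lambda>U. \<exists>a\<in>A. U = W a))"

lemma neg_oplus_self: "x \<in> A \<Longrightarrow> neg x \<oplus> x = neg zero"
  using mv_axiom[of x "neg zero"]
  by (metis neg_closed neg_neg oplus_closed oplus_comm oplus_neg_zero oplus_zero zero_closed)

lemma le_oplus: "\<lbrakk>x \<in> A; y \<in> A\<rbrakk> \<Longrightarrow> le x (x \<oplus> y)"
  unfolding le_def ominus_def
  by (metis neg_closed neg_neg neg_oplus_self oplus_assoc oplus_comm oplus_neg_zero zero_closed)

lemma W_Int:
  assumes "a \<in> A" "b \<in> A"
  shows "W a \<inter> W b = W (a \<oplus> b)"
proof -
  have "le a (a \<oplus> b)" "le b (a \<oplus> b)"
    using assms le_oplus[of a b] le_oplus[of b a] oplus_comm[of a b] by simp_all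
  then show ?thesis
    using assms unfolding W_def prime_ideal_def is_ideal_def by blast
qed

text \<open>Since \<^const>\<open>topology\<close> is unspecified on predicates that are not topologies, the
  following two facts show that \<^const>\<open>Z\<close> is the intended space.\<close>

lemma openin_Z: "openin Z = arbitrary union_of (\<lambda>U. \<exists>a\<in>A. U = W a)"
  unfolding Z_def
proof (rule topology_inverse'[OF istopology_base])
  fix S T
  assume "\<exists>a\<in>A. S = W a" "\<exists>a\<in>A. T = W a"
  then show "\<exists>a\<in>A. S \<inter> T = W a"
    using W_Int oplus_closed by metis
qed

lemma topspace_Z: "topspace Z = {P. prime_ideal P}"
proof
  show "topspace Z \<subseteq> {P. prime_ideal P}"
    using openin_topspace[of Z] unfolding openin_Z
    by (auto simp: union_of_def W_def)
  have "W zero = {P. prime_ideal P}"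
    by (auto simp: W_def prime_ideal_def is_ideal_def)
  moreover have "openin Z (W zero)"
    unfolding openin_Z using zero_closed by (auto intro!: arbitrary_union_of_inc)
  ultimately show "{P. prime_ideal P} \<subseteq> topspace Z"
    using openin_subset by metis
qed

end

definition irreducible_closedin :: "'a topology \<Rightarrow> 'a set \<Rightarrow> bool"
  where "irreducible_closedin X C \<longleftrightarrow>
    closedin X C \<and> C \<noteq> {} \<and>
    (\<forall>D E. closedin X D \<and> closedin X E \<and> C = D \<union> E \<longrightarrow> C = D \<or> C = E)"

definition sober_space :: "'a topology \<Rightarrow> bool"
  where "sober_space X \<longleftrightarrow>
    (\<forall>C. irreducible_closedin X C \<longrightarrow> (\<exists>!x. x \<in> topspace X \<and> X closure_of {x} = C))"

definition base_of :: "'a topology \<Rightarrow> 'a set set \<Rightarrow> bool"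
  where "base_of X \<B> \<longleftrightarrow> openin X = arbitrary union_of (\<lambda>U. U \<in> \<B>)"

end

theory Submission
  imports Defs "HOL-Analysis.Function_Topology"
begin

text \<open>
  Both halves of the theorem rest on the shape of the definition of a prime ideal: membership of
  a set \<open>P \<subseteq> A\<close> in the spectrum is expressed by clauses, each of which constrains the truth
  values of only finitely many statements \<open>a \<in> P\<close>.

  Compactness. Identify subsets of \<open>A\<close> with points of the Cantor cube of exponent \<open>A\<close>, which is
  compact by Tychonoff's theorem. A clause on finitely many coordinates cuts out a clopen set of
  the cube, so the prime ideals that contain a given \<open>a\<close> form a closed, hence compact, set of
  points. The topology that the cube induces on the spectrum is finer than the coZariski
  topology, since the basic set of \<open>b\<close> is given by the single coordinate \<open>b\<close>. So every basic
  open set is a continuous image of a compact set (\<open>compactin_W\<close>). The whole space is the basic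
  set of \<open>0\<close>.

  Sobriety. In the coZariski topology the closure of a point \<open>P\<close> consists of the prime ideals
  contained in \<open>P\<close> (\<open>closure_of_prime_ideal\<close>). So the only candidate for the generic point of a
  closed set \<open>C\<close> is its largest element, which must be \<open>\<Union>C\<close>. Among the clauses that define a
  prime ideal, closure under \<open>\<oplus>\<close> is the only one that does not pass trivially to unions of
  nonempty families, and for irreducible \<open>C\<close> it holds because \<open>W a \<inter> W b = W (a \<oplus> b)\<close> must meet
  \<open>C\<close> as soon as \<open>W a\<close> and \<open>W b\<close> do (\<open>prime_ideal_Union_irreducible\<close>). The union belongs to \<open>C\<close>
  because a basic neighbourhood \<open>W a\<close> of it, that is \<open>a \<in> \<Union>C\<close>, contains an element of \<open>C\<close>.
\<close>

section \<open>The Cantor cube\<close>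

abbreviation cantor_cube :: "'a set \<Rightarrow> ('a \<Rightarrow> bool) topology"
  where "cantor_cube A \<equiv> product_topology (\<lambda>_. discrete_topology UNIV) A"

lemma compact_space_cantor_cube: "compact_space (cantor_cube A)"
  by (simp add: compact_space_product_topology compact_space_discrete_topology)

lemma cantor_cube_coordinate:
  assumes "a \<in> A"
  shows openin_cantor_cube_coordinate: "openin (cantor_cube A) {f \<in> topspace (cantor_cube A). f a}"
    and closedin_cantor_cube_coordinate: "closedin (cantor_cube A) {f \<in> topspace (cantor_cube A). f a}"
    and closedin_cantor_cube_not_coordinate:
      "closedin (cantor_cube A) {f \<in> topspace (cantor_cube A). \<not> f a}"
proof -
  have cont: "continuous_map (cantor_cube A) (discrete_topology UNIV) (\<lambda>f. f a)"
    using assms by (rule continuous_map_product_projection)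
  show "openin (cantor_cube A) {f \<in> topspace (cantor_cube A). f a}"
    using openin_continuous_map_preimage[OF cont, of "{True}"] by simp
  show "closedin (cantor_cube A) {f \<in> topspace (cantor_cube A). f a}"
    using closedin_continuous_map_preimage[OF cont, of "{True}"] by simp
  show "closedin (cantor_cube A) {f \<in> topspace (cantor_cube A). \<not> f a}"
    using closedin_continuous_map_preimage[OF cont, of "{False}"] by simp
qed

lemma closedin_Collect_conj:
  assumes "closedin X {x \<in> topspace X. P x}" "closedin X {x \<in> topspace X. Q x}"
  shows "closedin X {x \<in> topspace X. P x \<and> Q x}"
proof -
  have "{x \<in> topspace X. P x \<and> Q x} = {x \<in> topspace X. P x} \<inter> {x \<in> topspace X. Q x}"
    by blast
  then show ?thesis
    using closedin_Int[OF assms] by simp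
qed

lemma closedin_Collect_disj:
  assumes "closedin X {x \<in> topspace X. P x}" "closedin X {x \<in> topspace X. Q x}"
  shows "closedin X {x \<in> topspace X. P x \<or> Q x}"
proof -
  have "{x \<in> topspace X. P x \<or> Q x} = {x \<in> topspace X. P x} \<union> {x \<in> topspace X. Q x}"
    by blast
  then show ?thesis
    using closedin_Un[OF assms] by simp
qed

lemma closedin_Collect_Ball:
  assumes "\<And>i. i \<in> I \<Longrightarrow> closedin X {x \<in> topspace X. P i x}"
  shows "closedin X {x \<in> topspace X. \<forall>i\<in>I. P i x}"
proof (cases "I = {}")
  case False
  then have "{x \<in> topspace X. \<forall>i\<in>I. P i x} = (\<Inter>i\<in>I. {x \<in> topspace X. P i x})"
    by blast
  then show ?thesis
    using False assms by (simp add: closedin_INT)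
qed simp

section \<open>Irreducible closed sets\<close>

text \<open>
  The form in which irreducibility is used: nonempty relatively open subsets of \<open>C\<close> intersect,
  since otherwise their complements in \<open>C\<close> would be two proper closed sets that cover \<open>C\<close>.
\<close>

lemma irreducible_closedin_Int:
  assumes C: "irreducible_closedin X C"
    and U: "openin X U" "C \<inter> U \<noteq> {}"
    and V: "openin X V" "C \<inter> V \<noteq> {}"
  shows "C \<inter> (U \<inter> V) \<noteq> {}"
proof
  assume "C \<inter> (U \<inter> V) = {}"
  then have "C = (C - U) \<union> (C - V)"
    by blast
  moreover have "closedin X (C - U)" "closedin X (C - V)"
    using C U(1) V(1) by (auto simp: irreducible_closedin_def)
  ultimately have "C = C - U \<or> C = C - V"
    using C unfolding irreducible_closedin_def by blast
  then show False
    using U(2) V(2) by blast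
qed

section \<open>The coZariski topology\<close>

context mv_algebra
begin

lemma ominus_closed: "\<lbrakk>x \<in> A; y \<in> A\<rbrakk> \<Longrightarrow> x \<ominus> y \<in> A"
  by (simp add: ominus_def neg_closed oplus_closed)

lemma one_closed: "one \<in> A"
  by (simp add: one_def neg_closed zero_closed)

text \<open>
  The definition rewritten as clauses on finitely many truth values \<open>a \<in> P\<close>, with the order
  relation of \<open>A\<close> moved into the range of a quantifier: this is the form to which the closure
  rules for subsets of the cube apply.
\<close>

lemma prime_ideal_iff:
  assumes "P \<subseteq> A"
  shows "prime_ideal P \<longleftrightarrow>
    zero \<in> P \<and> one \<notin> P \<and>
    (\<forall>y\<in>A. \<forall>x\<in>{x \<in> A. le x y}. y \<notin> P \<or> x \<in> P) \<and>
    (\<forall>x\<in>A. \<forall>y\<in>A. x \<notin> P \<or> y \<notin> P \<or> x \<oplus> y \<in> P) \<and>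
    (\<forall>x\<in>A. \<forall>y\<in>A. x \<ominus> y \<in> P \<or> y \<ominus> x \<in> P)"
  using assms unfolding prime_ideal_def is_ideal_def by blast

lemma prime_ideal_subset: "prime_ideal P \<Longrightarrow> P \<subseteq> A"
  by (simp add: prime_ideal_def is_ideal_def)

lemma prime_ideal_zero: "prime_ideal P \<Longrightarrow> zero \<in> P"
  by (simp add: prime_ideal_def is_ideal_def)

lemma prime_ideal_le: "\<lbrakk>prime_ideal P; y \<in> P; x \<in> A; le x y\<rbrakk> \<Longrightarrow> x \<in> P"
  by (auto simp: prime_ideal_def is_ideal_def)

lemma openin_W: "a \<in> A \<Longrightarrow> openin Z (W a)"
  unfolding openin_Z by (auto intro!: arbitrary_union_of_inc)

lemma topspace_eq_W_zero: "topspace Z = W zero"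
  by (auto simp: topspace_Z W_def prime_ideal_zero)

lemma openin_Z_iff:
  "openin Z U \<longleftrightarrow> U \<subseteq> topspace Z \<and> (\<forall>P\<in>U. \<exists>a\<in>A. P \<in> W a \<and> W a \<subseteq> U)"
proof
  assume "openin Z U"
  then show "U \<subseteq> topspace Z \<and> (\<forall>P\<in>U. \<exists>a\<in>A. P \<in> W a \<and> W a \<subseteq> U)"
    using openin_subset[of Z U] unfolding openin_Z arbitrary_union_of_alt by blast
next
  assume "U \<subseteq> topspace Z \<and> (\<forall>P\<in>U. \<exists>a\<in>A. P \<in> W a \<and> W a \<subseteq> U)"
  then show "openin Z U"
    unfolding openin_Z arbitrary_union_of_alt by blast
qed

section \<open>Compactness of the basic open sets\<close>

lemma closedin_prime_ideals:
  "closedin (cantor_cube A) {f \<in> topspace (cantor_cube A). prime_ideal {a \<in> A. f a}}"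
proof -
  have "{f \<in> topspace (cantor_cube A). prime_ideal {a \<in> A. f a}} =
    {f \<in> topspace (cantor_cube A). f zero \<and> \<not> f one \<and>
      (\<forall>y\<in>A. \<forall>x\<in>{x \<in> A. le x y}. \<not> f y \<or> f x) \<and>
      (\<forall>x\<in>A. \<forall>y\<in>A. \<not> f x \<or> \<not> f y \<or> f (x \<oplus> y)) \<and>
      (\<forall>x\<in>A. \<forall>y\<in>A. f (x \<ominus> y) \<or> f (y \<ominus> x))}"
    by (subst prime_ideal_iff) (auto simp: zero_closed one_closed oplus_closed ominus_closed)
  moreover have "closedin (cantor_cube A) \<dots>"
    by (intro closedin_Collect_conj closedin_Collect_disj closedin_Collect_Ball
        closedin_cantor_cube_coordinate closedin_cantor_cube_not_coordinate)
      (auto simp: zero_closed one_closed oplus_closed ominus_closed)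
  ultimately show ?thesis
    by simp
qed

text \<open>
  The set of points of the cube that encode elements of \<open>W a\<close> is compact, being closed in a compact
  space, and decoding is continuous because the preimage of \<open>W b\<close> is given by the coordinate \<open>b\<close>.
\<close>

lemma compactin_W:
  assumes "a \<in> A"
  shows "compactin Z (W a)"
proof -
  define K where "K = {f \<in> topspace (cantor_cube A). prime_ideal {b \<in> A. f b}}"
  define g :: "('a \<Rightarrow> bool) \<Rightarrow> 'a set" where "g f = {b \<in> A. f b}" for f
  have K_top: "K \<subseteq> topspace (cantor_cube A)"
    by (auto simp: K_def)
  have g_K: "prime_ideal (g f)" if "f \<in> K" for f
    using that by (simp add: K_def g_def)
  have "continuous_map (subtopology (cantor_cube A) K) Z g"
    unfolding continuous_map_def
  proof (intro conjI allI impI)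
    show "g \<in> topspace (subtopology (cantor_cube A) K) \<rightarrow> topspace Z"
      using g_K by (auto simp: topspace_Z)
  next
    fix U
    assume U: "openin Z U"
    let ?T = "subtopology (cantor_cube A) K"
    show "openin ?T {f \<in> topspace ?T. g f \<in> U}"
    proof (subst openin_subopen, intro ballI)
      fix f
      assume f: "f \<in> {f \<in> topspace ?T. g f \<in> U}"
      then obtain b where b: "b \<in> A" "g f \<in> W b" "W b \<subseteq> U"
        using U unfolding openin_Z_iff by blast
      let ?N = "{h \<in> topspace (cantor_cube A). h b} \<inter> K"
      have "openin ?T ?N"
        using openin_cantor_cube_coordinate[OF b(1)] by (auto simp: openin_subtopology)
      moreover have "f \<in> ?N"
        using f b(2) by (auto simp: W_def g_def)
      moreover have "?N \<subseteq> {f \<in> topspace ?T. g f \<in> U}"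
      proof
        fix h
        assume h: "h \<in> ?N"
        then have "g h \<in> W b"
          using b(1) g_K by (simp add: W_def g_def)
        then show "h \<in> {f \<in> topspace ?T. g f \<in> U}"
          using h b(3) by auto
      qed
      ultimately show "\<exists>N. openin ?T N \<and> f \<in> N \<and> N \<subseteq> {f \<in> topspace ?T. g f \<in> U}"
        by blast
    qed
  qed
  moreover have "compactin (subtopology (cantor_cube A) K) {f \<in> K. f a}"
  proof -
    have "{f \<in> K. f a} = {f \<in> topspace (cantor_cube A). prime_ideal {b \<in> A. f b} \<and> f a}"
      by (auto simp: K_def)
    then have "closedin (cantor_cube A) {f \<in> K. f a}"
      using closedin_Collect_conj[OF closedin_prime_ideals closedin_cantor_cube_coordinate[OF assms]]
      by simp
    then show ?thesis
      using closedin_compact_space[OF compact_space_cantor_cube]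
      by (auto simp: compactin_subtopology)
  qed
  ultimately have "compactin Z (g ` {f \<in> K. f a})"
    using image_compactin by blast
  moreover have "g ` {f \<in> K. f a} = W a"
  proof
    show "g ` {f \<in> K. f a} \<subseteq> W a"
      using assms g_K by (auto simp: W_def g_def)
  next
    show "W a \<subseteq> g ` {f \<in> K. f a}"
    proof
      fix P
      assume P: "P \<in> W a"
      then have "P \<subseteq> A"
        by (auto simp: W_def dest: prime_ideal_subset)
      \<comment> \<open>Points of the cube are extensional functions, so the indicator function of \<open>P\<close> has to be
        cut off outside \<open>A\<close>.\<close>
      let ?f = "restrict (\<lambda>b. b \<in> P) A"
      have gf: "{b \<in> A. ?f b} = P"
        using \<open>P \<subseteq> A\<close> by auto
      have "?f \<in> K" "?f a"
        using P gf assms by (auto simp: K_def W_def)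
      then show "P \<in> g ` {f \<in> K. f a}"
        using gf unfolding g_def by blast
    qed
  qed
  ultimately show ?thesis
    by simp
qed

lemma compact_space_Z: "compact_space Z"
  using compactin_W[OF zero_closed] by (simp add: compact_space_def topspace_eq_W_zero)

section \<open>Sobriety\<close>

text \<open>
  The inclusion is reversed in comparison with the Zariski topology, because basic open sets are
  given by membership and not by nonmembership.
\<close>

lemma closure_of_prime_ideal:
  assumes "prime_ideal P"
  shows "Z closure_of {P} = {Q. prime_ideal Q \<and> Q \<subseteq> P}"
proof (intro subset_antisym subsetI)
  fix Q
  assume Q: "Q \<in> Z closure_of {P}"
  then have "prime_ideal Q"
    by (simp add: in_closure_of topspace_Z)
  moreover have "a \<in> P" if "a \<in> Q" for a
  proof -
    have "a \<in> A" "Q \<in> W a"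
      using that \<open>prime_ideal Q\<close> prime_ideal_subset by (auto simp: W_def)
    then have "P \<in> W a"
      using Q openin_W unfolding in_closure_of by blast
    then show ?thesis
      by (simp add: W_def)
  qed
  ultimately show "Q \<in> {Q. prime_ideal Q \<and> Q \<subseteq> P}"
    by blast
next
  fix Q
  assume Q: "Q \<in> {Q. prime_ideal Q \<and> Q \<subseteq> P}"
  have "P \<in> U" if U: "Q \<in> U" "openin Z U" for U
  proof -
    obtain a where "Q \<in> W a" "W a \<subseteq> U"
      using U unfolding openin_Z_iff by blast
    then show ?thesis
      using Q assms by (auto simp: W_def)
  qed
  then show "Q \<in> Z closure_of {P}"
    using Q by (auto simp: in_closure_of topspace_Z)
qed

text \<open>
  If \<open>x\<close> and \<open>y\<close> lie in elements of \<open>C\<close>, irreducibility provides an element of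
  \<open>C\<close> that contains both, and hence their sum. The condition on \<open>\<ominus>\<close> holds in one element of \<open>C\<close>, and every
  larger set inherits it.
\<close>

lemma prime_ideal_Union_irreducible:
  assumes C: "irreducible_closedin Z C"
  shows "prime_ideal (\<Union>C)"
proof -
  have prime: "prime_ideal Q" if "Q \<in> C" for Q
    using C that closedin_subset[of Z C] by (auto simp: irreducible_closedin_def topspace_Z)
  obtain Q where Q: "Q \<in> C"
    using C by (auto simp: irreducible_closedin_def)
  have sub: "\<Union>C \<subseteq> A"
    using prime prime_ideal_subset by blast
  have "x \<oplus> y \<in> \<Union>C" if xy: "x \<in> \<Union>C" "y \<in> \<Union>C" for x y
  proof -
    have A: "x \<in> A" "y \<in> A"
      using sub xy by auto
    have "C \<inter> W x \<noteq> {}" "C \<inter> W y \<noteq> {}"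
      using xy prime by (auto simp: W_def)
    then have "C \<inter> (W x \<inter> W y) \<noteq> {}"
      using irreducible_closedin_Int[OF C] openin_W A by blast
    then show ?thesis
      using W_Int[OF A] by (auto simp: W_def)
  qed
  moreover have "one \<notin> \<Union>C"
    using prime by (auto simp: prime_ideal_def)
  moreover have "x \<in> \<Union>C" if "x \<in> A" "le x y" "y \<in> \<Union>C" for x y
    using that prime prime_ideal_le by blast
  moreover have "zero \<in> \<Union>C"
    using Q prime prime_ideal_zero by blast
  moreover have "\<forall>x\<in>A. \<forall>y\<in>A. x \<ominus> y \<in> \<Union>C \<or> y \<ominus> x \<in> \<Union>C"
    using Q prime[OF Q] unfolding prime_ideal_def by blast
  ultimately show ?thesis
    using sub unfolding prime_ideal_def is_ideal_def by blast
qed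

lemma closure_of_Union_irreducible:
  assumes C: "irreducible_closedin Z C"
  shows "Z closure_of {\<Union>C} = C"
proof -
  have closed: "closedin Z C"
    using C by (simp add: irreducible_closedin_def)
  have prime: "prime_ideal (\<Union>C)"
    using C by (rule prime_ideal_Union_irreducible)
  have "\<exists>Q. Q \<in> C \<and> Q \<in> U" if U: "\<Union>C \<in> U" "openin Z U" for U
  proof -
    obtain a where a: "\<Union>C \<in> W a" "W a \<subseteq> U"
      using U unfolding openin_Z_iff by blast
    then obtain Q where "Q \<in> C" "a \<in> Q"
      by (auto simp: W_def)
    then have "Q \<in> W a"
      using closedin_subset[OF closed] by (auto simp: W_def topspace_Z)
    then show ?thesis
      using \<open>Q \<in> C\<close> a(2) by blast
  qed
  \<comment> \<open>Every neighbourhood of \<open>\<Union>C\<close> meets \<open>C\<close>, so the closed set \<open>C\<close> has \<open>\<Union>C\<close> as an element.\<close>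
  then have "\<Union>C \<in> Z closure_of C"
    using prime by (auto simp: in_closure_of topspace_Z)
  then have "\<Union>C \<in> C"
    using closed by (simp add: closure_of_closedin)
  then have "Z closure_of {\<Union>C} \<subseteq> C"
    using closed by (simp add: closure_of_minimal)
  moreover have "C \<subseteq> Z closure_of {\<Union>C}"
    using closedin_subset[OF closed] by (auto simp: closure_of_prime_ideal[OF prime] topspace_Z)
  ultimately show ?thesis
    by blast
qed

lemma sober_space_Z: "sober_space Z"
  unfolding sober_space_def
proof (intro allI impI ex_ex1I)
  fix C
  assume C: "irreducible_closedin Z C"
  show "\<exists>P. P \<in> topspace Z \<and> Z closure_of {P} = C"
    using prime_ideal_Union_irreducible[OF C] closure_of_Union_irreducible[OF C]
    by (auto simp: topspace_Z)
next
  fix C P Q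
  assume PQ: "P \<in> topspace Z \<and> Z closure_of {P} = C" "Q \<in> topspace Z \<and> Z closure_of {Q} = C"
  then have prime: "prime_ideal P" "prime_ideal Q"
    by (simp_all add: topspace_Z)
  moreover have "{R. prime_ideal R \<and> R \<subseteq> P} = {R. prime_ideal R \<and> R \<subseteq> Q}"
    using PQ closure_of_prime_ideal[OF prime(1)] closure_of_prime_ideal[OF prime(2)] by metis
  ultimately show "P = Q"
    by blast
qed

lemma base_of_Z: "base_of Z (W ` A)"
  unfolding base_of_def openin_Z by (simp add: image_iff)

end

theorem lemma3p8:
  fixes A :: "'a set"
    and oplus :: "'a \<Rightarrow> 'a \<Rightarrow> 'a"
    and neg :: "'a \<Rightarrow> 'a"
    and zero :: 'a
  assumes "mv_algebra A oplus neg zero"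
  defines "X \<equiv> mv_algebra.Z A oplus neg zero"
  shows "sober_space X \<and> compact_space X \<and>
    (\<exists>\<B>. base_of X \<B> \<and> (\<forall>U\<in>\<B>. openin X U \<and> compactin X U))"
proof -
  interpret mv_algebra A oplus neg zero
    by fact
  have "\<forall>U\<in>W ` A. openin Z U \<and> compactin Z U"
    using openin_W compactin_W by blast
  then show ?thesis
    using sober_space_Z compact_space_Z base_of_Z unfolding X_def by blast
qed

end
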